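(* Let $N\ge 2$ and let $\mathscr{T}_{LR}=\mathscr{M}_l+\mathscr{A}_l+\mathscr{M}_r+\mathscr{A}_r$ be the substructured operator of the $N$-strip domain decomposition of the Helmholtz problem in left-right numbering, with $C_r=(I-\mathscr{M}_r)^{-1}\mathscr{A}_r$ and $C_l=(I-\mathscr{M}_l)^{-1}\mathscr{A}_l$. Let $$M^{-1}_{BSGS}:=(I-\mathscr{M}_r-\mathscr{M}_l-\mathscr{A}_l)^{-1}(I-\mathscr{M}_r-\mathscr{M}_l)(I-\mathscr{M}_r-\mathscr{M}_l-\mathscr{A}_r)^{-1}$$ be the Block Symmetric Gauss-Seidel preconditioner for $I-\mathscr{T}_{LR}$, and let $R_{BSGS}:=M_{BSGS}^{-1}\bigl(M_{BSGS}-(I-\mathscr{T}_{LR})\bigr)$ be its error propagation operator. Then $$R_{BSGS}=(I+C_l)\,C_r\,C_l,$$ and for every integer $n\ge1$, $$R_{BSGS}^n=(I+C_l)\,(C_r\,C_l)^{n}.$$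
   Context: Setting. A bounded domain $\Omega\subset\mathbb{R}^2$ is decomposed into $N\ge 2$ successive strips $\Omega_1,\dots,\Omega_N$ (with or without overlap). The part of $\partial\Omega_i\setminus\partial\Omega$ on the left (right) of $\Omega_i$ is the interface $\Gamma_{i,l}$ ($\Gamma_{i,r}$); $\Gamma_{1,l}=\Gamma_{N,r}=\emptyset$. Linear interface operators $\mathcal{B}_{i,l}$ ($2\le i\le N$) and $\mathcal{B}_{i,r}$ ($1\le i\le N-1$) are given, with traces taken on $\Gamma_{i,l}$ and $\Gamma_{i,r}$. For interface functions $h_l,h_r$ and a source $f$, $S_i(h_l,h_r,f)$ denotes the solution $v$ of $(-k^2-\Delta)v=f$ in $\Omega_i$, $\mathcal{B}_{i,l}(v)=h_l$ on $\Gamma_{i,l}$ (if $i\ge2$), $\mathcal{B}_{i,r}(v)=h_r$ on $\Gamma_{i,r}$ (if $i\le N-1$), with fixed linear homogeneous boundary conditions on $\partial\Omega\cap\partial\Omega_i$; these local problems are assumed well posed, so that $S_i$ is linear (for $i=1$ the argument $h_l$ is ignored, for $i=N$ the argument $h_r$ is ignored). Substructured operator. The unknowns are interface functions ordered in the left-right (LR) numbering $(h_{2,l},h_{3,l},\dots,h_{N,l},h_{N-1,r},h_{N-2,r},\dots,h_{1,r})$, i.e. $2N-2$ components. $\mathscr{T}_{LR}$ is the $(2N-2)\times(2N-2)$ matrix of linear operators whose only possibly nonzero entries (row index first, column index second) are $\mathscr{T}_{(i+1,l)(i,l)}=\mathcal{B}_{i+1,l}(S_i(\cdot,0,0))$ for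 $2\le i\le N-1$; $\mathscr{T}_{(i+1,l)(i,r)}=\mathcal{B}_{i+1,l}(S_i(0,\cdot,0))$ for $1\le i\le N-1$; $\mathscr{T}_{(i-1,r)(i,r)}=\mathcal{B}_{i-1,r}(S_i(0,\cdot,0))$ for $2\le i\le N-1$; $\mathscr{T}_{(i-1,r)(i,l)}=\mathcal{B}_{i-1,r}(S_i(\cdot,0,0))$ for $2\le i\le N$. Submatrices. $I$ is the identity. Let $I_l$ (resp. $I_r$) be the diagonal $(2N-2)\times(2N-2)$ matrix with diagonal entries $1$ in positions $1,\dots,N-1$ (resp. $N,\dots,2N-2$) and $0$ elsewhere. Set $\mathscr{M}_l:=I_l^T\mathscr{T}_{LR}I_l$, $\mathscr{A}_l:=I_l^T\mathscr{T}_{LR}I_r$, $\mathscr{A}_r:=I_r^T\mathscr{T}_{LR}I_l$, $\mathscr{M}_r:=I_r^T\mathscr{T}_{LR}I_r$. The matrices $\mathscr{M}_l,\mathscr{M}_r$ are strictly lower triangular with $\mathscr{M}_l^{N-1}=\mathscr{M}_r^{N-1}=0$. Define $C_r:=(I-\mathscr{M}_r)^{-1}\mathscr{A}_r=\bigl(\sum_{i=0}^{N-2}\mathscr{M}_r^i\bigr)\mathscr{A}_r$ and $C_l:=(I-\mathscr{M}_l)^{-1}\mathscr{A}_l=\bigl(\sum_{i=0}^{N-2}\mathscr{M}_l^i\bigr)\mathscr{A}_l$. Error propagation operator. For a preconditioner $M^{-1}$ (with inverse $M$) of a linear operator $B$, the error propagation operator is $R:=M^{-1}(M-B)$; here $B=I-\mathscr{T}_{LR}$.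 *)

theory Defs
  imports "HOL-Analysis.Analysis" "HOL-Library.Function_Algebras" "HOL-Algebra.Ring"
begin

section \<open>The Helmholtz equation in the sense of distributions\<close>

definition partial_deriv :: "2 \<Rightarrow> (real^2 \<Rightarrow> complex) \<Rightarrow> real^2 \<Rightarrow> complex" where
  "partial_deriv j f x = vector_derivative (\<lambda>t. f (x + t *\<^sub>R axis j 1)) (at 0)"

fun C_k :: "nat \<Rightarrow> (real^2 \<Rightarrow> complex) \<Rightarrow> bool" where
  "C_k 0 f = continuous_on UNIV f"
| "C_k (Suc m) f = (continuous_on UNIV f \<and>
     (\<forall>j. (\<forall>x. (\<lambda>t::real. f (x + t *\<^sub>R axis j 1)) differentiable (at 0)) \<and> C_k m (partial_deriv j f)))"

definition laplacian :: "(real^2 \<Rightarrow> complex) \<Rightarrow> real^2 \<Rightarrow> complex" where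
  "laplacian f x = (\<Sum>j\<in>UNIV. partial_deriv j (partial_deriv j f) x)"

definition test_function :: "(real^2) set \<Rightarrow> (real^2 \<Rightarrow> complex) \<Rightarrow> bool" where
  "test_function U \<phi> \<longleftrightarrow> (\<forall>m. C_k m \<phi>) \<and>
     compact (closure {x. \<phi> x \<noteq> 0}) \<and> closure {x. \<phi> x \<noteq> 0} \<subseteq> U"

definition locally_integrable :: "(real^2) set \<Rightarrow> (real^2 \<Rightarrow> complex) \<Rightarrow> bool" where
  "locally_integrable U f \<longleftrightarrow> (\<forall>K. compact K \<and> K \<subseteq> U \<longrightarrow> set_integrable lebesgue K f)"

text \<open>\<open>(-k\<^sup>2 - \<Delta>) v = f\<close> in the open set \<open>U\<close>, as distributions. For twice continuously
  differentiable \<open>v\<close> and continuous \<open>f\<close> this is the pointwise equation.\<close>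

definition helmholtz_eq ::
  "complex \<Rightarrow> (real^2) set \<Rightarrow> (real^2 \<Rightarrow> complex) \<Rightarrow> (real^2 \<Rightarrow> complex) \<Rightarrow> bool" where
  "helmholtz_eq k U v f \<longleftrightarrow> (\<forall>\<phi>. test_function U \<phi> \<longrightarrow>
     set_lebesgue_integral lebesgue U (\<lambda>x. v x * (- k\<^sup>2 * \<phi> x - laplacian \<phi> x)) =
     set_lebesgue_integral lebesgue U (\<lambda>x. f x * \<phi> x))"

section \<open>Strip decompositions\<close>

datatype side = LeftS | RightS

text \<open>Only strips \<open>1, \<dots>, nstrips\<close> and the interfaces of \<open>is_interface\<close> below are meaningful.

  The functions in \<open>sol_space P i\<close> and \<open>src_space P i\<close> are considered on the \<open>i\<close>-th strip only, up
  to null sets. The interface spaces are subspaces of a common complex vector space \<open>'h\<close> with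
  scalar multiplication \<open>ifc_scale\<close>. Its elements need not be pointwise functions, since natural
  data spaces on an interface, such as those of Robin data, consist of distributions.

  \<open>ifc_op P i s j\<close> is the interface operator \<open>\<B>\<^bsub>i,s\<^esub>\<close> applied to functions living on the \<open>j\<close>-th
  strip; \<open>j\<close> is \<open>i\<close> in the local problems and a neighbour of \<open>i\<close> in the substructured operator.
  The index \<open>j\<close> tells from which side the traces are taken.

  \<open>bdry_op P i v = 0\<close> is the fixed homogeneous condition on the outer boundary of strip \<open>i\<close>.\<close>

record ('h, 'b) strip_decomposition =
  nstrips :: nat
  domain_set :: "(real^2) set"
  strip :: "nat \<Rightarrow> (real^2) set"
  wavenumber :: complex
  sol_space :: "nat \<Rightarrow> (real^2 \<Rightarrow> complex) set"
  src_space :: "nat \<Rightarrow> (real^2 \<Rightarrow> complex) set"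
  ifc_space :: "nat \<Rightarrow> side \<Rightarrow> 'h set"
  ifc_scale :: "complex \<Rightarrow> 'h \<Rightarrow> 'h"
  ifc_op :: "nat \<Rightarrow> side \<Rightarrow> nat \<Rightarrow> (real^2 \<Rightarrow> complex) \<Rightarrow> 'h"
  bdry_scale :: "complex \<Rightarrow> 'b \<Rightarrow> 'b"
  bdry_op :: "nat \<Rightarrow> (real^2 \<Rightarrow> complex) \<Rightarrow> 'b"

definition is_interface :: "('h, 'b) strip_decomposition \<Rightarrow> nat \<Rightarrow> side \<Rightarrow> bool" where
  "is_interface P i s \<longleftrightarrow>
     (case s of LeftS \<Rightarrow> 2 \<le> i \<and> i \<le> nstrips P | RightS \<Rightarrow> 1 \<le> i \<and> i \<le> nstrips P - 1)"

definition neighbour :: "nat \<Rightarrow> side \<Rightarrow> nat" where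
  "neighbour i s = (case s of LeftS \<Rightarrow> i - 1 | RightS \<Rightarrow> i + 1)"

text \<open>The strips are numbered from left to right, so the part of \<open>\<partial>\<Omega>\<^sub>i - \<partial>\<Omega>\<close> to the left (right)
  of \<open>\<Omega>\<^sub>i\<close> is the part lying in the closure of the preceding (following) strip.\<close>

definition interface :: "('h, 'b) strip_decomposition \<Rightarrow> nat \<Rightarrow> side \<Rightarrow> (real^2) set" where
  "interface P i s = (if is_interface P i s
     then (frontier (strip P i) - frontier (domain_set P)) \<inter> closure (strip P (neighbour i s))
     else {})"

abbreviation fun_scale :: "complex \<Rightarrow> (real^2 \<Rightarrow> complex) \<Rightarrow> real^2 \<Rightarrow> complex" where
  "fun_scale \<equiv> \<lambda>c v x. c * v x"

definition linear_between ::
  "(complex \<Rightarrow> 'u \<Rightarrow> 'u) \<Rightarrow> (complex \<Rightarrow> 'w \<Rightarrow> 'w) \<Rightarrow>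
   ('u::ab_group_add) set \<Rightarrow> ('w::ab_group_add) set \<Rightarrow> ('u \<Rightarrow> 'w) \<Rightarrow> bool" where
  "linear_between su sw U W f \<longleftrightarrow> f \<in> U \<rightarrow> W \<and>
     (\<forall>x\<in>U. \<forall>y\<in>U. f (x + y) = f x + f y) \<and> (\<forall>c. \<forall>x\<in>U. f (su c x) = sw c (f x))"

text \<open>The traces occurring in \<open>f\<close> are taken on \<open>G\<close>: functions on \<open>D\<close> that agree near \<open>G\<close> have
  the same image.\<close>

definition trace_on ::
  "(real^2) set \<Rightarrow> (real^2) set \<Rightarrow> (real^2 \<Rightarrow> complex) set \<Rightarrow> ((real^2 \<Rightarrow> complex) \<Rightarrow> 'w) \<Rightarrow> bool" where
  "trace_on G D V f \<longleftrightarrow> (\<forall>U. \<forall>v\<in>V. \<forall>w\<in>V. open U \<and> G \<subseteq> U \<and>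
     (AE x in lebesgue. x \<in> D \<inter> U \<longrightarrow> v x = w x) \<longrightarrow> f v = f w)"

definition is_local_solution ::
  "('h, 'b::zero) strip_decomposition \<Rightarrow> nat \<Rightarrow> 'h \<Rightarrow> 'h \<Rightarrow> (real^2 \<Rightarrow> complex) \<Rightarrow>
   (real^2 \<Rightarrow> complex) \<Rightarrow> bool" where
  "is_local_solution P i hl hr f v \<longleftrightarrow>
     v \<in> sol_space P i \<and>
     helmholtz_eq (wavenumber P) (strip P i) v f \<and>
     (i \<ge> 2 \<longrightarrow> ifc_op P i LeftS i v = hl) \<and>
     (i \<le> nstrips P - 1 \<longrightarrow> ifc_op P i RightS i v = hr) \<and>
     bdry_op P i v = 0"

text \<open>\<open>S\<^sub>i(h\<^sub>l, h\<^sub>r, f)\<close>, determined up to a null set of the strip by \<open>well_posed\<close> below.\<close>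

definition local_solution ::
  "('h, 'b::zero) strip_decomposition \<Rightarrow> nat \<Rightarrow> 'h \<Rightarrow> 'h \<Rightarrow> (real^2 \<Rightarrow> complex) \<Rightarrow>
   (real^2 \<Rightarrow> complex)" where
  "local_solution P i hl hr f = (SOME v. is_local_solution P i hl hr f v)"

locale helmholtz_strips =
  fixes P :: "('h::ab_group_add, 'b::ab_group_add) strip_decomposition"
  assumes two_strips: "nstrips P \<ge> 2"
    and domain: "open (domain_set P)" "connected (domain_set P)" "bounded (domain_set P)"
      "domain_set P \<noteq> {}"
    and strips: "\<And>i. i \<in> {1..nstrips P} \<Longrightarrow>
      open (strip P i) \<and> strip P i \<noteq> {} \<and> strip P i \<subseteq> domain_set P"
    and cover: "closure (domain_set P) = (\<Union>i\<in>{1..nstrips P}. closure (strip P i))"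
    and interfaces: "\<And>i. i \<in> {1..nstrips P} \<Longrightarrow>
      frontier (strip P i) - frontier (domain_set P) = interface P i LeftS \<union> interface P i RightS \<and>
      interface P i LeftS \<inter> interface P i RightS = {}"
    and ifc_vector_space: "vector_space (ifc_scale P)"
    and bdry_vector_space: "vector_space (bdry_scale P)"
    and ifc_space: "\<And>i s. is_interface P i s \<Longrightarrow> module.subspace (ifc_scale P) (ifc_space P i s)"
    and sol_space: "\<And>i. i \<in> {1..nstrips P} \<Longrightarrow>
      module.subspace fun_scale (sol_space P i) \<and> Ball (sol_space P i) (locally_integrable (strip P i))"
    and src_space: "\<And>i. i \<in> {1..nstrips P} \<Longrightarrow>
      module.subspace fun_scale (src_space P i) \<and> Ball (src_space P i) (locally_integrable (strip P i))"
    and ifc_op: "\<And>i s j. is_interface P i s \<Longrightarrow> j \<in> {i, neighbour i s} \<Longrightarrow>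
      linear_between fun_scale (ifc_scale P) (sol_space P j) (ifc_space P i s) (ifc_op P i s j) \<and>
      trace_on (interface P i s) (strip P j) (sol_space P j) (ifc_op P i s j)"
    and bdry_op: "\<And>i. i \<in> {1..nstrips P} \<Longrightarrow>
      linear_between fun_scale (bdry_scale P) (sol_space P i) UNIV (bdry_op P i) \<and>
      trace_on (frontier (domain_set P) \<inter> frontier (strip P i)) (strip P i) (sol_space P i)
        (bdry_op P i)"
    and well_posed: "\<And>i hl hr f. i \<in> {1..nstrips P} \<Longrightarrow>
      (i \<ge> 2 \<Longrightarrow> hl \<in> ifc_space P i LeftS) \<Longrightarrow>
      (i \<le> nstrips P - 1 \<Longrightarrow> hr \<in> ifc_space P i RightS) \<Longrightarrow>
      f \<in> src_space P i \<Longrightarrow>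
      (\<exists>v. is_local_solution P i hl hr f v) \<and>
      (\<forall>v w. is_local_solution P i hl hr f v \<and> is_local_solution P i hl hr f w \<longrightarrow>
         (AE x in lebesgue. x \<in> strip P i \<longrightarrow> v x = w x))"

section \<open>Matrices of linear operators in left-right numbering\<close>

text \<open>Positions are \<open>1, \<dots>, 2N - 2\<close>, holding the components
  \<open>(2,l), \<dots>, (N,l), (N-1,r), \<dots>, (1,r)\<close>.\<close>

definition positions :: "('h, 'b) strip_decomposition \<Rightarrow> nat set" where
  "positions P = {1..2 * nstrips P - 2}"

definition LR :: "('h, 'b) strip_decomposition \<Rightarrow> nat \<Rightarrow> nat \<times> side" where
  "LR P p = (if p \<le> nstrips P - 1 then (p + 1, LeftS) else (2 * nstrips P - 1 - p, RightS))"

definition comp_space :: "('h, 'b) strip_decomposition \<Rightarrow> nat \<Rightarrow> 'h set" where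
  "comp_space P p = (case LR P p of (i, s) \<Rightarrow> ifc_space P i s)"

type_synonym 'h op_matrix = "nat \<Rightarrow> nat \<Rightarrow> 'h \<Rightarrow> 'h"

text \<open>Entry \<open>(p, q)\<close> maps the space of component \<open>q\<close> to the space of component \<open>p\<close>. Off that space,
  and at positions outside the matrix, it is \<open>0\<close>, so that equality of functions is equality of
  matrices of operators.\<close>

definition normalize_matrix ::
  "('h::zero, 'b) strip_decomposition \<Rightarrow> 'h op_matrix \<Rightarrow> 'h op_matrix" where
  "normalize_matrix P A = (\<lambda>p q h.
     if p \<in> positions P \<and> q \<in> positions P \<and> h \<in> comp_space P q then A p q h else 0)"

definition op_matrices :: "('h::ab_group_add, 'b) strip_decomposition \<Rightarrow> 'h op_matrix set" where
  "op_matrices P = {A. normalize_matrix P A = A \<and>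
     (\<forall>p\<in>positions P. \<forall>q\<in>positions P.
        linear_between (ifc_scale P) (ifc_scale P) (comp_space P q) (comp_space P p) (A p q))}"

definition matrix_ring :: "('h::ab_group_add, 'b) strip_decomposition \<Rightarrow> 'h op_matrix ring" where
  "matrix_ring P = \<lparr>carrier = op_matrices P,
     monoid.mult = (\<lambda>A B p q h. \<Sum>r\<in>positions P. A p r (B r q h)),
     one = normalize_matrix P (\<lambda>p q h. if p = q then h else 0),
     zero = (\<lambda>p q h. 0),
     add = (\<lambda>A B p q h. A p q h + B p q h)\<rparr>"

definition matrix_transpose :: "'h op_matrix \<Rightarrow> 'h op_matrix" where
  "matrix_transpose A = (\<lambda>p q. A q p)"

section \<open>The substructured operator and its splitting\<close>

fun T_entry ::
  "('h::zero, 'b::zero) strip_decomposition \<Rightarrow> nat \<times> side \<Rightarrow> nat \<times> side \<Rightarrow> 'h \<Rightarrow> 'h" where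
  "T_entry P (j, LeftS) (i, LeftS) h =
     (if j = i + 1 \<and> 2 \<le> i \<and> i \<le> nstrips P - 1
      then ifc_op P (i + 1) LeftS i (local_solution P i h 0 (\<lambda>_. 0)) else 0)"
| "T_entry P (j, LeftS) (i, RightS) h =
     (if j = i + 1 \<and> 1 \<le> i \<and> i \<le> nstrips P - 1
      then ifc_op P (i + 1) LeftS i (local_solution P i 0 h (\<lambda>_. 0)) else 0)"
| "T_entry P (j, RightS) (i, RightS) h =
     (if j = i - 1 \<and> 2 \<le> i \<and> i \<le> nstrips P - 1
      then ifc_op P (i - 1) RightS i (local_solution P i 0 h (\<lambda>_. 0)) else 0)"
| "T_entry P (j, RightS) (i, LeftS) h =
     (if j = i - 1 \<and> 2 \<le> i \<and> i \<le> nstrips P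
      then ifc_op P (i - 1) RightS i (local_solution P i h 0 (\<lambda>_. 0)) else 0)"

definition T_LR :: "('h::zero, 'b::zero) strip_decomposition \<Rightarrow> 'h op_matrix" where
  "T_LR P = normalize_matrix P (\<lambda>p q. T_entry P (LR P p) (LR P q))"

definition I_l :: "('h::zero, 'b) strip_decomposition \<Rightarrow> 'h op_matrix" where
  "I_l P = normalize_matrix P (\<lambda>p q h. if p = q \<and> p \<in> {1..nstrips P - 1} then h else 0)"

definition I_r :: "('h::zero, 'b) strip_decomposition \<Rightarrow> 'h op_matrix" where
  "I_r P = normalize_matrix P
     (\<lambda>p q h. if p = q \<and> p \<in> {nstrips P..2 * nstrips P - 2} then h else 0)"

context
  fixes P :: "('h::ab_group_add, 'b::ab_group_add) strip_decomposition"
begin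

definition M_l :: "'h op_matrix" where
  "M_l = matrix_transpose (I_l P) \<otimes>\<^bsub>matrix_ring P\<^esub> T_LR P \<otimes>\<^bsub>matrix_ring P\<^esub> I_l P"

definition A_l :: "'h op_matrix" where
  "A_l = matrix_transpose (I_l P) \<otimes>\<^bsub>matrix_ring P\<^esub> T_LR P \<otimes>\<^bsub>matrix_ring P\<^esub> I_r P"

definition A_r :: "'h op_matrix" where
  "A_r = matrix_transpose (I_r P) \<otimes>\<^bsub>matrix_ring P\<^esub> T_LR P \<otimes>\<^bsub>matrix_ring P\<^esub> I_l P"

definition M_r :: "'h op_matrix" where
  "M_r = matrix_transpose (I_r P) \<otimes>\<^bsub>matrix_ring P\<^esub> T_LR P \<otimes>\<^bsub>matrix_ring P\<^esub> I_r P"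

definition C_r :: "'h op_matrix" where
  "C_r = inv\<^bsub>matrix_ring P\<^esub> (\<one>\<^bsub>matrix_ring P\<^esub> \<ominus>\<^bsub>matrix_ring P\<^esub> M_r) \<otimes>\<^bsub>matrix_ring P\<^esub> A_r"

definition C_l :: "'h op_matrix" where
  "C_l = inv\<^bsub>matrix_ring P\<^esub> (\<one>\<^bsub>matrix_ring P\<^esub> \<ominus>\<^bsub>matrix_ring P\<^esub> M_l) \<otimes>\<^bsub>matrix_ring P\<^esub> A_l"

text \<open>The inverse \<open>M\<^sup>-\<^sup>1\<close> of the preconditioner, as it is applied.\<close>

definition BSGS :: "'h op_matrix" where
  "BSGS =
     inv\<^bsub>matrix_ring P\<^esub> (\<one>\<^bsub>matrix_ring P\<^esub> \<ominus>\<^bsub>matrix_ring P\<^esub> M_r \<ominus>\<^bsub>matrix_ring P\<^esub> M_l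
       \<ominus>\<^bsub>matrix_ring P\<^esub> A_l)
     \<otimes>\<^bsub>matrix_ring P\<^esub> (\<one>\<^bsub>matrix_ring P\<^esub> \<ominus>\<^bsub>matrix_ring P\<^esub> M_r \<ominus>\<^bsub>matrix_ring P\<^esub> M_l)
     \<otimes>\<^bsub>matrix_ring P\<^esub>
     inv\<^bsub>matrix_ring P\<^esub> (\<one>\<^bsub>matrix_ring P\<^esub> \<ominus>\<^bsub>matrix_ring P\<^esub> M_r \<ominus>\<^bsub>matrix_ring P\<^esub> M_l
       \<ominus>\<^bsub>matrix_ring P\<^esub> A_r)"

end

text \<open>The first operator argument is the inverse of the preconditioner, \<open>M\<^sup>-\<^sup>1\<close>.\<close>

definition error_propagation :: "('a, 'm) ring_scheme \<Rightarrow> 'a \<Rightarrow> 'a \<Rightarrow> 'a" where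
  "error_propagation R Minv B = Minv \<otimes>\<^bsub>R\<^esub> (inv\<^bsub>R\<^esub> Minv \<ominus>\<^bsub>R\<^esub> B)"

definition R_BSGS :: "('h::ab_group_add, 'b::ab_group_add) strip_decomposition \<Rightarrow> 'h op_matrix" where
  "R_BSGS P = error_propagation (matrix_ring P) (BSGS P)
     (\<one>\<^bsub>matrix_ring P\<^esub> \<ominus>\<^bsub>matrix_ring P\<^esub> T_LR P)"

end

theory Submission
  imports Defs
begin

text \<open>
  Split the components into left and right ones and view the substructured operator as a matrix with
  two by two blocks: diagonal blocks \<open>\<M>\<^sub>l\<close>, \<open>\<M>\<^sub>r\<close> and off-diagonal blocks \<open>\<A>\<^sub>l\<close>, \<open>\<A>\<^sub>r\<close>. Put
  \<open>D = I - \<M>\<^sub>r - \<M>\<^sub>l\<close>. The block pattern makes \<open>D\<close> the product of \<open>I - \<M>\<^sub>r\<close> and \<open>I - \<M>\<^sub>l\<close> and gives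
  \<open>D C\<^sub>l = \<A>\<^sub>l\<close> and \<open>D C\<^sub>r = \<A>\<^sub>r\<close>. Hence the triangular parts are \<open>D (I - C\<^sub>l)\<close> and \<open>D (I - C\<^sub>r)\<close>, and the
  whole operator is \<open>D (I - C\<^sub>l - C\<^sub>r)\<close>. Since \<open>C\<^sub>l\<close> and \<open>C\<^sub>r\<close> are off-diagonal, their squares vanish,
  and the error propagation operator becomes
  \<open>I - (I + C\<^sub>l) (I + C\<^sub>r) (I - C\<^sub>l - C\<^sub>r) = (I + C\<^sub>l) C\<^sub>r C\<^sub>l\<close>. In a power of it, \<open>C\<^sub>l (I + C\<^sub>l) = C\<^sub>l\<close> removes
  all factors \<open>I + C\<^sub>l\<close> but the first. This computation takes place in an arbitrary ring:
  \<open>block_splitting_gauss_seidel_error\<close> and \<open>pow_one_plus_square_zero_mult\<close>.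

  What remains is to see that the matrices of operators do form a ring containing the substructured
  operator (\<open>ring_matrix_ring\<close>, \<open>T_LR_closed\<close>) and that \<open>I - \<M>\<^sub>l\<close> and \<open>I - \<M>\<^sub>r\<close> are invertible in it.
  Invertibility holds because the diagonal blocks are strictly lower triangular, hence nilpotent
  (\<open>one_minus_strictly_lower_Units\<close>). Membership in the ring means that the entries are linear
  (\<open>T_entry_linear\<close>). This is where the Helmholtz problems enter: homogeneous local problems obey
  superposition, their solutions are unique up to null sets, and traces ignore null sets.
\<close>

section \<open>Symmetric Gauss-Seidel errors in a ring\<close>

text \<open>The inverse is the finite Neumann series. Only its two telescoping identities matter, so the
  partial sums are produced by induction instead of being written as a sum in the ring.\<close>

lemma (in ring) one_minus_nilpotent_Units:
  assumes x: "x \<in> carrier R" and nil: "x [^] (n::nat) = \<zero>"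
  shows "\<one> \<ominus> x \<in> Units R"
proof -
  have "\<exists>s\<in>carrier R. (\<one> \<ominus> x) \<otimes> s = \<one> \<ominus> x [^] k \<and> s \<otimes> (\<one> \<ominus> x) = \<one> \<ominus> x [^] k" for k :: nat
  proof (induction k)
    case 0
    show ?case using x by (intro bexI[of _ \<zero>]) (auto simp: minus_eq r_neg)
  next
    case (Suc k)
    then obtain s where s: "s \<in> carrier R" "(\<one> \<ominus> x) \<otimes> s = \<one> \<ominus> x [^] k"
      "s \<otimes> (\<one> \<ominus> x) = \<one> \<ominus> x [^] k"
      by blast
    have comm: "x \<otimes> x [^] k = x [^] k \<otimes> x"
      using x by (metis nat_pow_Suc nat_pow_Suc2)
    have telescope: "\<one> \<ominus> x [^] k \<oplus> (x [^] k \<ominus> y) = \<one> \<ominus> y" if "y \<in> carrier R" for y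
      using x that by (simp add: minus_eq a_assoc r_neg1)
    have "(\<one> \<ominus> x) \<otimes> (s \<oplus> x [^] k) = \<one> \<ominus> x [^] k \<oplus> (x [^] k \<ominus> x \<otimes> x [^] k)"
      using x s by (simp add: r_distr) (simp add: minus_eq l_distr l_minus)
    moreover have "(s \<oplus> x [^] k) \<otimes> (\<one> \<ominus> x) = \<one> \<ominus> x [^] k \<oplus> (x [^] k \<ominus> x [^] k \<otimes> x)"
      using x s by (simp add: l_distr) (simp add: minus_eq r_distr r_minus)
    ultimately show ?case
      using x s comm telescope by (intro bexI[of _ "s \<oplus> x [^] k"]) auto
  qed
  from this[of n] obtain s where "s \<in> carrier R" "(\<one> \<ominus> x) \<otimes> s = \<one>" "s \<otimes> (\<one> \<ominus> x) = \<one>"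
    using nil by (auto simp: minus_eq)
  then show ?thesis
    unfolding Units_def using x by auto
qed

lemma (in ring) one_minus_square_zero_inverse:
  assumes c: "c \<in> carrier R" and sq: "c \<otimes> c = \<zero>"
  shows "(\<one> \<ominus> c) \<otimes> (\<one> \<oplus> c) = \<one>" and "(\<one> \<oplus> c) \<otimes> (\<one> \<ominus> c) = \<one>"
  using assms by (simp_all add: minus_eq l_distr r_distr l_minus r_minus a_assoc r_neg l_neg)

lemma (in monoid) inv_mult_of_inverse:
  assumes D: "D \<in> Units G" and u: "u \<in> carrier G" and v: "v \<in> carrier G"
    and uv: "u \<otimes> v = \<one>" "v \<otimes> u = \<one>"
  shows "inv (D \<otimes> u) = v \<otimes> inv D"
proof -
  have u_unit: "u \<in> Units G" using u v uv unfolding Units_def by blast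
  then have unit: "D \<otimes> u \<in> Units G" using D by simp
  have "v \<otimes> inv D \<otimes> (D \<otimes> u) = v \<otimes> (inv D \<otimes> D) \<otimes> u"
    using D u v Units_inv_closed[OF D] Units_closed[OF D] by (simp only: m_assoc m_closed)
  also have "\<dots> = \<one>" using D u v uv by simp
  finally have left: "v \<otimes> inv D \<otimes> (D \<otimes> u) = \<one>" .
  show "inv (D \<otimes> u) = v \<otimes> inv D"
    using inv_unique[OF left Units_r_inv[OF unit]] D u v unit by (simp add: Units_closed)
qed

text \<open>This is the heart of the proof. As \<open>cl\<close> and \<open>cr\<close> square to zero, \<open>1 - cl\<close> and \<open>1 - cr\<close> have
  the inverses \<open>1 + cl\<close> and \<open>1 + cr\<close>; the inverse preconditioner is thus
  \<open>Q = (1 + cl) (1 + cr) D\<^sup>-\<^sup>1\<close>, and \<open>D\<close> cancels in \<open>1 - Q B\<close> for \<open>B = D (1 - cl - cr)\<close>. Next,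
  \<open>(1 + cr) (1 - cl - cr) = 1 - cl - cr cl\<close>, because \<open>cr\<close> cancels and \<open>cr cr = 0\<close>. Multiplying by
  \<open>1 + cl\<close> turns \<open>1 - cl\<close> into \<open>1\<close> and leaves \<open>Q B = 1 - (1 + cl) cr cl\<close>.\<close>

lemma (in ring) symmetric_gauss_seidel_error:
  assumes D: "D \<in> Units R" and carr: "cl \<in> carrier R" "cr \<in> carrier R"
    and sq: "cl \<otimes> cl = \<zero>" "cr \<otimes> cr = \<zero>"
  shows "error_propagation R (inv (D \<otimes> (\<one> \<ominus> cl)) \<otimes> D \<otimes> inv (D \<otimes> (\<one> \<ominus> cr))) (D \<otimes> (\<one> \<ominus> cl \<ominus> cr))
    = (\<one> \<oplus> cl) \<otimes> cr \<otimes> cl"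
proof -
  define Q where "Q = (\<one> \<oplus> cl) \<otimes> (\<one> \<oplus> cr) \<otimes> inv D"
  have Dc: "D \<in> carrier R" "inv D \<in> carrier R" using D by auto
  have "inv (D \<otimes> (\<one> \<ominus> cl)) \<otimes> D \<otimes> inv (D \<otimes> (\<one> \<ominus> cr))
      = (\<one> \<oplus> cl) \<otimes> inv D \<otimes> D \<otimes> ((\<one> \<oplus> cr) \<otimes> inv D)"
    using carr inv_mult_of_inverse[OF D _ _ one_minus_square_zero_inverse[OF carr(1) sq(1)]]
      inv_mult_of_inverse[OF D _ _ one_minus_square_zero_inverse[OF carr(2) sq(2)]]
    by simp
  also have "\<dots> = (\<one> \<oplus> cl) \<otimes> (inv D \<otimes> D) \<otimes> ((\<one> \<oplus> cr) \<otimes> inv D)"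
    using Dc carr by (simp only: m_assoc m_closed a_closed one_closed)
  also have "\<dots> = Q" unfolding Q_def using D Dc carr by (simp add: m_assoc)
  finally have Minv: "inv (D \<otimes> (\<one> \<ominus> cl)) \<otimes> D \<otimes> inv (D \<otimes> (\<one> \<ominus> cr)) = Q" .
  have units: "\<one> \<oplus> cl \<in> Units R" "\<one> \<oplus> cr \<in> Units R"
    using one_minus_square_zero_inverse[OF carr(1) sq(1)]
      one_minus_square_zero_inverse[OF carr(2) sq(2)] carr
    unfolding Units_def by auto
  have Q: "Q \<in> Units R" unfolding Q_def using units D by auto
  have QB: "Q \<otimes> (D \<otimes> (\<one> \<ominus> cl \<ominus> cr)) = (\<one> \<oplus> cl) \<otimes> ((\<one> \<oplus> cr) \<otimes> (\<one> \<ominus> cl \<ominus> cr))"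
  proof -
    have "Q \<otimes> (D \<otimes> (\<one> \<ominus> cl \<ominus> cr)) = (\<one> \<oplus> cl) \<otimes> (\<one> \<oplus> cr) \<otimes> (inv D \<otimes> D) \<otimes> (\<one> \<ominus> cl \<ominus> cr)"
      unfolding Q_def using Dc carr by (simp only: m_assoc m_closed a_closed one_closed minus_closed)
    then show ?thesis using D carr by (simp add: m_assoc)
  qed
  have "(\<one> \<oplus> cr) \<otimes> (\<one> \<ominus> cl \<ominus> cr) = (\<one> \<ominus> cl \<ominus> cr) \<oplus> (cr \<ominus> cr \<otimes> cl)"
    using carr sq by (simp add: minus_eq l_distr r_distr r_minus minus_add a_ac)
  also have "\<dots> = (\<one> \<ominus> cl) \<ominus> cr \<otimes> cl"
    using carr by (simp add: minus_eq a_assoc r_neg1)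
  finally have inner: "(\<one> \<oplus> cr) \<otimes> (\<one> \<ominus> cl \<ominus> cr) = (\<one> \<ominus> cl) \<ominus> cr \<otimes> cl" .
  have "(\<one> \<oplus> cl) \<otimes> ((\<one> \<ominus> cl) \<ominus> cr \<otimes> cl) = (\<one> \<oplus> cl) \<otimes> (\<one> \<ominus> cl) \<ominus> (\<one> \<oplus> cl) \<otimes> (cr \<otimes> cl)"
    using carr by (simp add: minus_eq[of "\<one> \<ominus> cl"] minus_eq[of "_ \<otimes> _"] r_distr[of "\<one> \<ominus> cl"] r_minus)
  also have "\<dots> = \<one> \<ominus> (\<one> \<oplus> cl) \<otimes> cr \<otimes> cl"
    using one_minus_square_zero_inverse(2)[OF carr(1) sq(1)] carr by (simp add: m_assoc)
  finally have product: "Q \<otimes> (D \<otimes> (\<one> \<ominus> cl \<ominus> cr)) = \<one> \<ominus> (\<one> \<oplus> cl) \<otimes> cr \<otimes> cl"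
    using QB inner by simp
  have "error_propagation R Q (D \<otimes> (\<one> \<ominus> cl \<ominus> cr)) = \<one> \<ominus> Q \<otimes> (D \<otimes> (\<one> \<ominus> cl \<ominus> cr))"
    unfolding error_propagation_def
    using Q Dc carr by (simp add: minus_eq[of "inv Q"] minus_eq[of \<one> "Q \<otimes> _"] r_distr r_minus Units_closed)
  also have "\<dots> = (\<one> \<oplus> cl) \<otimes> cr \<otimes> cl"
    unfolding product using carr by (simp add: minus_eq[of \<one>] minus_add a_assoc[symmetric] r_neg)
  finally show ?thesis unfolding Minv .
qed

text \<open>Between two consecutive factors stands \<open>cl (1 + cl) = cl\<close>, so that only the leftmost \<open>1 + cl\<close>
  survives. The zeroth power is excluded: it would give \<open>1\<close> on the left and \<open>1 + cl\<close> on the right.\<close>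

lemma (in ring) pow_one_plus_square_zero_mult:
  assumes carr: "cl \<in> carrier R" "cr \<in> carrier R" and sq: "cl \<otimes> cl = \<zero>" and n: "n \<ge> (1::nat)"
  shows "((\<one> \<oplus> cl) \<otimes> cr \<otimes> cl) [^] n = (\<one> \<oplus> cl) \<otimes> (cr \<otimes> cl) [^] n"
  using n
proof (induction n rule: dec_induct)
  case base
  show ?case using carr by (simp add: m_assoc)
next
  case (step m)
  have absorb: "cr \<otimes> cl \<otimes> (\<one> \<oplus> cl) = cr \<otimes> cl"
    using carr sq by (simp add: r_distr m_assoc)
  obtain k where k: "m = Suc k" using step.hyps(1) by (cases m) auto
  have pow_absorb: "(cr \<otimes> cl) [^] m \<otimes> (\<one> \<oplus> cl) = (cr \<otimes> cl) [^] m"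
    using carr absorb unfolding k by (simp add: m_assoc)
  have "((\<one> \<oplus> cl) \<otimes> cr \<otimes> cl) [^] Suc m = (\<one> \<oplus> cl) \<otimes> (cr \<otimes> cl) [^] m \<otimes> ((\<one> \<oplus> cl) \<otimes> cr \<otimes> cl)"
    using step.IH by simp
  also have "\<dots> = (\<one> \<oplus> cl) \<otimes> ((cr \<otimes> cl) [^] m \<otimes> (\<one> \<oplus> cl)) \<otimes> (cr \<otimes> cl)"
    using carr by (simp only: m_assoc m_closed a_closed one_closed nat_pow_closed)
  also have "\<dots> = (\<one> \<oplus> cl) \<otimes> (cr \<otimes> cl) [^] Suc m"
    using carr unfolding pow_absorb by (simp add: m_assoc)
  finally show ?case .
qed

text \<open>Multiply \<open>a = a (1 - m)\<close> by the inverse from the right.\<close>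

lemma (in ring) right_factor_absorbs_inverse:
  assumes carr: "a \<in> carrier R" "m \<in> carrier R" and unit: "\<one> \<ominus> m \<in> Units R" and zero: "a \<otimes> m = \<zero>"
  shows "a \<otimes> inv (\<one> \<ominus> m) = a"
proof -
  have "a = a \<otimes> (\<one> \<ominus> m)"
    using carr zero by (simp add: minus_eq r_distr r_minus)
  then have "a \<otimes> inv (\<one> \<ominus> m) = a \<otimes> ((\<one> \<ominus> m) \<otimes> inv (\<one> \<ominus> m))"
    using carr unit by (metis m_assoc Units_closed Units_inv_closed)
  then show ?thesis using carr unit by simp
qed

text \<open>Reduces a two-by-two block splitting, with diagonal blocks \<open>Ml\<close>, \<open>Mr\<close> and off-diagonal blocks
  \<open>Al\<close>, \<open>Ar\<close>, to the previous computation. The zero products are those that the block pattern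
  forces. They give \<open>D = (1 - Mr) (1 - Ml)\<close>, \<open>D Cl = Al\<close> and \<open>D Cr = Ar\<close>, so \<open>D\<close> can be factored out
  of both triangular parts and out of the whole operator.\<close>

lemma (in ring) block_splitting_gauss_seidel_error:
  assumes carr: "Ml \<in> carrier R" "Mr \<in> carrier R" "Al \<in> carrier R" "Ar \<in> carrier R"
    and units: "\<one> \<ominus> Ml \<in> Units R" "\<one> \<ominus> Mr \<in> Units R"
    and diag: "Mr \<otimes> Ml = \<zero>" "Ml \<otimes> Mr = \<zero>"
    and off_sq: "Al \<otimes> Al = \<zero>" "Ar \<otimes> Ar = \<zero>"
    and off_diag: "Al \<otimes> Ml = \<zero>" "Ar \<otimes> Mr = \<zero>"
    and diag_off: "Mr \<otimes> Al = \<zero>" "Ml \<otimes> Ar = \<zero>"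
  defines "D \<equiv> \<one> \<ominus> Mr \<ominus> Ml"
    and "Cl \<equiv> inv (\<one> \<ominus> Ml) \<otimes> Al"
    and "Cr \<equiv> inv (\<one> \<ominus> Mr) \<otimes> Ar"
  shows "Cl \<in> carrier R" "Cr \<in> carrier R" "Cl \<otimes> Cl = \<zero>"
    "error_propagation R (inv (D \<ominus> Al) \<otimes> D \<otimes> inv (D \<ominus> Ar))
      (\<one> \<ominus> (Ml \<oplus> Al \<oplus> (Ar \<oplus> Mr))) = (\<one> \<oplus> Cl) \<otimes> Cr \<otimes> Cl"
proof -
  let ?ul = "\<one> \<ominus> Ml" and ?ur = "\<one> \<ominus> Mr"
  have inv_carr: "inv ?ul \<in> carrier R" "inv ?ur \<in> carrier R" using units by auto
  show Cl: "Cl \<in> carrier R" and Cr: "Cr \<in> carrier R"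
    using carr inv_carr by (simp_all add: Cl_def Cr_def)
  have AlCl: "Al \<otimes> Cl = \<zero>" and ArCr: "Ar \<otimes> Cr = \<zero>"
    using carr inv_carr units off_diag off_sq
    by (simp_all add: Cl_def Cr_def m_assoc[symmetric] right_factor_absorbs_inverse)
  show sql: "Cl \<otimes> Cl = \<zero>"
    using AlCl carr inv_carr Cl by (simp add: Cl_def m_assoc)
  have sqr: "Cr \<otimes> Cr = \<zero>"
    using ArCr carr inv_carr Cr by (simp add: Cr_def m_assoc)
  have D_factors: "D = ?ur \<otimes> ?ul"
    using carr diag by (simp add: D_def minus_eq l_distr r_distr l_minus r_minus)
  then have D: "D \<in> Units R" using units by simp
  have ulCl: "?ul \<otimes> Cl = Al" and urCr: "?ur \<otimes> Cr = Ar"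
    using carr units inv_carr by (simp_all add: Cl_def Cr_def m_assoc[symmetric] Units_closed)
  \<comment> \<open>Since \<open>Ml\<close> annihilates both \<open>Mr\<close> and \<open>Ar\<close>, the factor \<open>1 - Ml\<close> of \<open>D\<close> leaves \<open>Cr\<close> alone.\<close>
  have MlCr: "Ml \<otimes> Cr = \<zero>"
    using carr inv_carr units diag diag_off
    by (simp add: Cr_def m_assoc[symmetric] right_factor_absorbs_inverse)
  have DCl: "D \<otimes> Cl = Al"
  proof -
    have "D \<otimes> Cl = ?ur \<otimes> Al"
      unfolding D_factors using carr Cl ulCl by (simp add: m_assoc)
    then show ?thesis using carr diag_off by (simp add: minus_eq l_distr l_minus)
  qed
  have DCr: "D \<otimes> Cr = Ar"
  proof -
    have "?ul \<otimes> Cr = Cr" using MlCr carr Cr by (simp add: minus_eq l_distr l_minus)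
    then show ?thesis
      unfolding D_factors using carr Cr urCr by (simp add: m_assoc)
  qed
  have Dc: "D \<in> carrier R" using D by auto
  have factors: "D \<ominus> Al = D \<otimes> (\<one> \<ominus> Cl)" "D \<ominus> Ar = D \<otimes> (\<one> \<ominus> Cr)"
    "D \<ominus> Al \<ominus> Ar = D \<otimes> (\<one> \<ominus> Cl \<ominus> Cr)"
    using Dc Cl Cr DCl DCr by (simp_all add: minus_eq r_distr r_minus)
  have "\<one> \<ominus> (Ml \<oplus> Al \<oplus> (Ar \<oplus> Mr)) = D \<ominus> Al \<ominus> Ar"
    using carr by (simp add: D_def minus_eq minus_add a_ac)
  also note factors(3)
  finally have B: "\<one> \<ominus> (Ml \<oplus> Al \<oplus> (Ar \<oplus> Mr)) = D \<otimes> (\<one> \<ominus> Cl \<ominus> Cr)" .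
  show "error_propagation R (inv (D \<ominus> Al) \<otimes> D \<otimes> inv (D \<ominus> Ar))
      (\<one> \<ominus> (Ml \<oplus> Al \<oplus> (Ar \<oplus> Mr))) = (\<one> \<oplus> Cl) \<otimes> Cr \<otimes> Cl"
    unfolding B factors(1,2) using symmetric_gauss_seidel_error[OF D Cl Cr sql sqr] by simp
qed

section \<open>Superposition for the distributional Helmholtz equation\<close>

lemma partial_deriv_eq_0:
  assumes "open U" and zero: "\<And>y. y \<in> U \<Longrightarrow> f y = 0" and x: "x \<in> U"
  shows "partial_deriv j f x = 0"
proof -
  have "((\<lambda>t::real. x + t *\<^sub>R axis j 1) \<longlongrightarrow> x + 0 *\<^sub>R axis j 1) (nhds 0)"
    by (intro tendsto_intros filterlim_ident)
  then have "\<forall>\<^sub>F t in nhds (0::real). x + t *\<^sub>R axis j 1 \<in> U"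
    using \<open>open U\<close> x by (intro topological_tendstoD) auto
  then have "\<forall>\<^sub>F t in nhds (0::real). t \<in> UNIV \<longrightarrow> f (x + t *\<^sub>R axis j 1) = 0"
    by eventually_elim (simp add: zero)
  then have "vector_derivative (\<lambda>t::real. f (x + t *\<^sub>R axis j 1)) (at 0)
      = vector_derivative (\<lambda>t::real. 0 :: complex) (at 0)"
    by (rule vector_derivative_cong_eq) auto
  then show ?thesis by (simp add: partial_deriv_def)
qed

text \<open>The integrals that define distributional solutions are guaranteed to be additive only where the
  integrands are integrable. Here \<open>v\<close> is multiplied by a continuous function supported in the compact support of
  \<open>\<phi>\<close>, on which local integrability of \<open>v\<close> applies.\<close>

lemma test_function_helmholtz_integrable:
  assumes v: "locally_integrable U v" and \<phi>: "test_function U \<phi>"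
  shows "set_integrable lebesgue U (\<lambda>x. v x * (- k\<^sup>2 * \<phi> x - laplacian \<phi> x))"
proof -
  define K where "K = closure {x. \<phi> x \<noteq> 0}"
  define g where "g x = - k\<^sup>2 * \<phi> x - laplacian \<phi> x" for x
  have K: "compact K" "K \<subseteq> U" using \<phi> by (auto simp: test_function_def K_def)
  have "C_k (Suc (Suc 0)) \<phi>" using \<phi> unfolding test_function_def by blast
  then have "continuous_on UNIV \<phi>" "\<And>i j. continuous_on UNIV (partial_deriv i (partial_deriv j \<phi>))"
    by auto
  then have g_cont: "continuous_on UNIV g"
    unfolding g_def laplacian_def by (intro continuous_intros)
  have g_off: "g x = 0" if "x \<notin> K" for x
  proof -
    have "open (- K)" using K by (simp add: compact_imp_closed open_Compl)
    moreover have \<phi>_off: "\<phi> y = 0" if "y \<in> - K" for y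
      using that closure_subset[of "{x. \<phi> x \<noteq> 0}"] by (auto simp: K_def)
    ultimately have "partial_deriv i (partial_deriv j \<phi>) x = 0" for i j
      using \<open>x \<notin> K\<close> by (intro partial_deriv_eq_0[of "- K"]) auto
    then show ?thesis using \<phi>_off \<open>x \<notin> K\<close> by (simp add: g_def laplacian_def)
  qed
  have "set_integrable lebesgue K (\<lambda>x. g x * v x)"
  proof (rule absolutely_integrable_bounded_measurable_product[where h = "(*)"])
    show "bilinear ((*) :: complex \<Rightarrow> complex \<Rightarrow> complex)"
      by (simp add: bilinear_conv_bounded_bilinear bounded_bilinear_mult)
    show sets: "K \<in> sets lebesgue"
      using K by (simp add: lmeasurable_compact fmeasurableD)
    show "g \<in> borel_measurable (lebesgue_on K)"
      using g_cont sets by (meson continuous_imp_measurable_on_sets_lebesgue continuous_on_subset subset_UNIV)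
    show "bounded (g ` K)"
      using K g_cont by (meson compact_continuous_image compact_imp_bounded continuous_on_subset subset_UNIV)
    show "set_integrable lebesgue K v"
      using v K by (simp add: locally_integrable_def)
  qed
  moreover have "(\<lambda>x. indicator K x *\<^sub>R (g x * v x)) = (\<lambda>x. indicator U x *\<^sub>R (v x * g x))"
    using K g_off by (auto simp: fun_eq_iff indicator_def)
  ultimately show ?thesis by (simp add: set_integrable_def g_def)
qed

lemma helmholtz_eq_homogeneous_add:
  assumes "locally_integrable U v" "locally_integrable U w"
    and "helmholtz_eq k U v (\<lambda>_. 0)" "helmholtz_eq k U w (\<lambda>_. 0)"
  shows "helmholtz_eq k U (v + w) (\<lambda>_. 0)"
  unfolding helmholtz_eq_def
proof (intro allI impI)
  fix \<phi> assume \<phi>: "test_function U \<phi>"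
  let ?g = "\<lambda>x. - k\<^sup>2 * \<phi> x - laplacian \<phi> x"
  have "(LINT x:U|lebesgue. (v + w) x * ?g x) = (LINT x:U|lebesgue. v x * ?g x + w x * ?g x)"
    by (simp only: plus_fun_def distrib_right)
  also have "\<dots> = (LINT x:U|lebesgue. v x * ?g x) + (LINT x:U|lebesgue. w x * ?g x)"
    by (intro set_integral_add(2) test_function_helmholtz_integrable assms \<phi>)
  also have "\<dots> = 0"
    using assms(3,4) \<phi> by (simp only: helmholtz_eq_def) simp
  finally show "(LINT x:U|lebesgue. (v + w) x * ?g x) = (LINT x:U|lebesgue. 0 * \<phi> x)"
    by simp
qed

lemma helmholtz_eq_homogeneous_scale:
  assumes "helmholtz_eq k U v (\<lambda>_. 0)"
  shows "helmholtz_eq k U (\<lambda>x. c * v x) (\<lambda>_. 0)"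
  using assms by (simp add: helmholtz_eq_def mult.assoc)

section \<open>Linearity of the transmission between neighbouring strips\<close>

text \<open>Functions that agree almost everywhere on \<open>D\<close> agree near every set on which traces are taken.\<close>

lemma trace_on_AE_cong:
  assumes "trace_on G D V f" and "AE x in lebesgue. x \<in> D \<longrightarrow> v x = w x" and "v \<in> V" "w \<in> V"
  shows "f v = f w"
  using assms(1)[unfolded trace_on_def, rule_format, of v w UNIV] assms(2-4) by simp

lemma module_fun_scale: "module fun_scale"
  by unfold_locales (auto simp: fun_eq_iff algebra_simps)

context helmholtz_strips
begin

interpretation ifc: vector_space "ifc_scale P" by (rule ifc_vector_space)
interpretation bdry: vector_space "bdry_scale P" by (rule bdry_vector_space)
interpretation fun_mod: module fun_scale by (rule module_fun_scale)

definition admissible_data :: "nat \<Rightarrow> 'h \<Rightarrow> 'h \<Rightarrow> bool" where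
  "admissible_data i hl hr \<longleftrightarrow> (2 \<le> i \<longrightarrow> hl \<in> ifc_space P i LeftS) \<and>
     (i \<le> nstrips P - 1 \<longrightarrow> hr \<in> ifc_space P i RightS)"

lemma homogeneous_local_solution:
  assumes "i \<in> {1..nstrips P}" "admissible_data i hl hr"
  shows "is_local_solution P i hl hr (\<lambda>_. 0) (local_solution P i hl hr (\<lambda>_. 0))"
proof -
  have "(\<lambda>_. 0) \<in> src_space P i"
    using src_space[OF assms(1)] fun_mod.subspace_0 by (auto simp: zero_fun_def)
  then have "\<exists>v. is_local_solution P i hl hr (\<lambda>_. 0) v"
    using well_posed[OF assms(1)] assms(2) by (simp add: admissible_data_def)
  then show ?thesis unfolding local_solution_def by (rule someI_ex)
qed

text \<open>The chosen solution is determined only up to a null set, which traces do not see. Hence any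
  solution with the same data may replace it; this is what makes linearity of the entries provable
  although the choice of the solution itself need not be linear.\<close>

lemma ifc_op_local_solution:
  assumes i: "i \<in> {1..nstrips P}" and data: "admissible_data i hl hr"
    and js: "is_interface P j s" "i = neighbour j s"
    and v: "is_local_solution P i hl hr (\<lambda>_. 0) v"
  shows "ifc_op P j s i (local_solution P i hl hr (\<lambda>_. 0)) = ifc_op P j s i v"
proof -
  let ?w = "local_solution P i hl hr (\<lambda>_. 0)"
  have w: "is_local_solution P i hl hr (\<lambda>_. 0) ?w"
    using i data by (rule homogeneous_local_solution)
  have "(\<lambda>_. 0) \<in> src_space P i"
    using src_space[OF i] fun_mod.subspace_0 by (auto simp: zero_fun_def)
  then have "AE x in lebesgue. x \<in> strip P i \<longrightarrow> ?w x = v x"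
    using well_posed[OF i, of hl hr] data v w by (auto simp: admissible_data_def)
  moreover have "trace_on (interface P j s) (strip P i) (sol_space P i) (ifc_op P j s i)"
    using ifc_op[OF js(1), of i] js(2) by simp
  moreover have "?w \<in> sol_space P i" "v \<in> sol_space P i"
    using v w by (auto simp: is_local_solution_def)
  ultimately show ?thesis
    by (intro trace_on_AE_cong)
qed

lemma ifc_op_linear:
  assumes "is_interface P j s" "i \<in> {j, neighbour j s}"
  shows "linear_between fun_scale (ifc_scale P) (sol_space P i) (ifc_space P j s) (ifc_op P j s i)"
  using ifc_op[OF assms] by simp

lemma own_interface:
  assumes "i \<in> {1..nstrips P}"
  shows "2 \<le> i \<Longrightarrow> is_interface P i LeftS" "i \<le> nstrips P - 1 \<Longrightarrow> is_interface P i RightS"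
  using assms by (auto simp: is_interface_def)

lemma local_solution_add:
  assumes i: "i \<in> {1..nstrips P}"
    and v: "is_local_solution P i hl hr (\<lambda>_. 0) v" and w: "is_local_solution P i hl' hr' (\<lambda>_. 0) w"
  shows "is_local_solution P i (hl + hl') (hr + hr') (\<lambda>_. 0) (v + w)"
proof -
  have "locally_integrable (strip P i) v" "locally_integrable (strip P i) w" "v + w \<in> sol_space P i"
    using sol_space[OF i] v w fun_mod.subspace_add by (auto simp: is_local_solution_def)
  moreover have "bdry_op P i (v + w) = bdry_op P i v + bdry_op P i w"
    using bdry_op[OF i] v w by (auto simp: linear_between_def is_local_solution_def)
  moreover have "ifc_op P i s i (v + w) = ifc_op P i s i v + ifc_op P i s i w"
    if "is_interface P i s" for s
    using ifc_op_linear[OF that, of i] v w by (auto simp: linear_between_def is_local_solution_def)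
  ultimately show ?thesis
    using v w own_interface[OF i] helmholtz_eq_homogeneous_add
    unfolding is_local_solution_def by auto
qed

lemma local_solution_scale:
  assumes i: "i \<in> {1..nstrips P}" and v: "is_local_solution P i hl hr (\<lambda>_. 0) v"
  shows "is_local_solution P i (ifc_scale P c hl) (ifc_scale P c hr) (\<lambda>_. 0) (\<lambda>x. c * v x)"
proof -
  have "(\<lambda>x. c * v x) \<in> sol_space P i"
    using sol_space[OF i] v fun_mod.subspace_scale[of "sol_space P i" v c]
    by (auto simp: is_local_solution_def)
  moreover have "bdry_op P i (\<lambda>x. c * v x) = bdry_scale P c (bdry_op P i v)"
    using bdry_op[OF i] v by (auto simp: linear_between_def is_local_solution_def)
  moreover have "ifc_op P i s i (\<lambda>x. c * v x) = ifc_scale P c (ifc_op P i s i v)"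
    if "is_interface P i s" for s
    using ifc_op_linear[OF that, of i] v by (auto simp: linear_between_def is_local_solution_def)
  ultimately show ?thesis
    using v own_interface[OF i] helmholtz_eq_homogeneous_scale[of _ _ v c]
    unfolding is_local_solution_def by auto
qed

text \<open>The common form of all entries of the substructured operator: solve in strip \<open>i\<close> with a datum on
  its side \<open>t\<close> alone and take the trace at the interface \<open>(j, s)\<close> of the adjacent strip.\<close>

definition transmission :: "nat \<times> side \<Rightarrow> nat \<times> side \<Rightarrow> 'h \<Rightarrow> 'h" where
  "transmission = (\<lambda>(j, s) (i, t) h. ifc_op P j s i
     (local_solution P i (if t = LeftS then h else 0) (if t = RightS then h else 0) (\<lambda>_. 0)))"

lemma transmission_linear:
  assumes js: "is_interface P j s" and it: "is_interface P i t" and nb: "i = neighbour j s"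
  shows "linear_between (ifc_scale P) (ifc_scale P) (ifc_space P i t) (ifc_space P j s)
    (transmission (j, s) (i, t))"
proof -
  let ?hl = "\<lambda>h. if t = LeftS then h else 0" and ?hr = "\<lambda>h. if t = RightS then h else 0"
  let ?S = "\<lambda>h. local_solution P i (?hl h) (?hr h) (\<lambda>_. 0)"
  have i: "i \<in> {1..nstrips P}"
    using it by (cases t) (auto simp: is_interface_def)
  have spaces: "ifc.subspace (ifc_space P i s')" if "is_interface P i s'" for s'
    using ifc_space[OF that] .
  have data: "admissible_data i (?hl h) (?hr h)" if "h \<in> ifc_space P i t" for h
    using that own_interface[OF i] spaces ifc.subspace_0
    by (cases t) (auto simp: admissible_data_def)
  note sol = homogeneous_local_solution[OF i data]
  have lin: "linear_between fun_scale (ifc_scale P) (sol_space P i) (ifc_space P j s) (ifc_op P j s i)"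
    using ifc_op_linear[OF js, of i] nb by simp
  have sol_mem: "?S h \<in> sol_space P i" if "h \<in> ifc_space P i t" for h
    using sol[OF that] unfolding is_local_solution_def by blast
  have add: "ifc_op P j s i (?S (g + h)) = ifc_op P j s i (?S g) + ifc_op P j s i (?S h)"
    if g: "g \<in> ifc_space P i t" and h: "h \<in> ifc_space P i t" for g h
  proof -
    have gh: "g + h \<in> ifc_space P i t" using g h spaces[OF it] ifc.subspace_add by blast
    have "?hl g + ?hl h = ?hl (g + h)" "?hr g + ?hr h = ?hr (g + h)" by auto
    then have "is_local_solution P i (?hl (g + h)) (?hr (g + h)) (\<lambda>_. 0) (?S g + ?S h)"
      using local_solution_add[OF i sol[OF g] sol[OF h]] by simp
    \<comment> \<open>By superposition \<open>?S g + ?S h\<close> solves the problem whose chosen solution is \<open>?S (g + h)\<close>.\<close>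
    from ifc_op_local_solution[OF i data[OF gh] js nb this]
    show ?thesis using lin sol_mem g h unfolding linear_between_def by simp
  qed
  have scale: "ifc_op P j s i (?S (ifc_scale P c h)) = ifc_scale P c (ifc_op P j s i (?S h))"
    if h: "h \<in> ifc_space P i t" for c h
  proof -
    have ch: "ifc_scale P c h \<in> ifc_space P i t" using h spaces[OF it] ifc.subspace_scale by blast
    have "ifc_scale P c (?hl h) = ?hl (ifc_scale P c h)" "ifc_scale P c (?hr h) = ?hr (ifc_scale P c h)"
      by auto
    then have "is_local_solution P i (?hl (ifc_scale P c h)) (?hr (ifc_scale P c h)) (\<lambda>_. 0)
        (\<lambda>x. c * ?S h x)"
      using local_solution_scale[OF i sol[OF h], of c] by simp
    from ifc_op_local_solution[OF i data[OF ch] js nb this]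
    show ?thesis using lin sol_mem h unfolding linear_between_def by simp
  qed
  have "ifc_op P j s i (?S h) \<in> ifc_space P j s" if "h \<in> ifc_space P i t" for h
    using lin sol_mem[OF that] by (auto simp: linear_between_def)
  then show ?thesis
    using add scale by (simp add: linear_between_def transmission_def)
qed

text \<open>The index restrictions in the four kinds of entries all say the same: strip \<open>i\<close> lies on the other
  side of the interface \<open>(j, s)\<close>.\<close>

lemma T_entry_eq_transmission:
  assumes "is_interface P j s" "is_interface P i t"
  shows "T_entry P (j, s) (i, t) h = (if i = neighbour j s then transmission (j, s) (i, t) h else 0)"
  using assms by (cases s; cases t) (auto simp: is_interface_def neighbour_def transmission_def)

lemma T_entry_linear:
  assumes js: "is_interface P j s" and it: "is_interface P i t"
  shows "linear_between (ifc_scale P) (ifc_scale P) (ifc_space P i t) (ifc_space P j s)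
    (T_entry P (j, s) (i, t))"
proof (cases "i = neighbour j s")
  case True
  then have "T_entry P (j, s) (i, t) = transmission (j, s) (i, t)"
    using T_entry_eq_transmission[OF assms] by auto
  then show ?thesis using transmission_linear[OF js it True] by simp
next
  case False
  then have "T_entry P (j, s) (i, t) = (\<lambda>_. 0)"
    using T_entry_eq_transmission[OF assms] by auto
  then show ?thesis
    using ifc.subspace_0[OF ifc_space[OF js]] by (simp add: linear_between_def)
qed

section \<open>The ring of matrices of operators\<close>

abbreviation op_linear :: "'h set \<Rightarrow> 'h set \<Rightarrow> ('h \<Rightarrow> 'h) \<Rightarrow> bool" where
  "op_linear \<equiv> linear_between (ifc_scale P) (ifc_scale P)"

lemma LR_is_interface:
  assumes "p \<in> positions P" "LR P p = (i, s)"
  shows "is_interface P i s"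
  using assms two_strips by (auto simp: positions_def LR_def is_interface_def split: if_splits)

lemma comp_space_subspace: "p \<in> positions P \<Longrightarrow> ifc.subspace (comp_space P p)"
  using LR_is_interface ifc_space by (cases "LR P p") (auto simp: comp_space_def)

lemma finite_positions: "finite (positions P)"
  by (simp add: positions_def)

lemma normalize_matrix_closed:
  assumes "\<And>p q. p \<in> positions P \<Longrightarrow> q \<in> positions P \<Longrightarrow>
    op_linear (comp_space P q) (comp_space P p) (A p q)"
  shows "normalize_matrix P A \<in> op_matrices P"
proof -
  have "op_linear (comp_space P q) (comp_space P p) (normalize_matrix P A p q)"
    if "p \<in> positions P" "q \<in> positions P" for p q
    using assms[OF that] that comp_space_subspace[OF that(2)]
    by (auto simp: linear_between_def normalize_matrix_def ifc.subspace_add ifc.subspace_scale)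
  then show ?thesis by (simp add: op_matrices_def) (simp add: normalize_matrix_def fun_eq_iff)
qed

lemma op_matrices_iff:
  "A \<in> op_matrices P \<longleftrightarrow>
    (\<forall>p q h. p \<notin> positions P \<or> q \<notin> positions P \<or> h \<notin> comp_space P q \<longrightarrow> A p q h = 0) \<and>
    (\<forall>p\<in>positions P. \<forall>q\<in>positions P. op_linear (comp_space P q) (comp_space P p) (A p q))"
  by (auto simp: op_matrices_def normalize_matrix_def fun_eq_iff)

lemma op_matrix_outside:
  "A \<in> op_matrices P \<Longrightarrow> p \<notin> positions P \<or> q \<notin> positions P \<or> h \<notin> comp_space P q \<Longrightarrow> A p q h = 0"
  by (simp add: op_matrices_iff)

lemma op_matrix_0:
  assumes "A \<in> op_matrices P" shows "A p q 0 = 0"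
proof (cases "p \<in> positions P \<and> q \<in> positions P")
  case True
  then have "op_linear (comp_space P q) (comp_space P p) (A p q)" "0 \<in> comp_space P q"
    using assms comp_space_subspace ifc.subspace_0 by (auto simp: op_matrices_iff)
  then have "A p q (0 + 0) = A p q 0 + A p q 0" unfolding linear_between_def by blast
  then show ?thesis by simp
qed (use assms in \<open>auto simp: op_matrix_outside\<close>)

lemma op_matrix_mem:
  assumes "A \<in> op_matrices P" "p \<in> positions P" shows "A p q h \<in> comp_space P p"
proof (cases "q \<in> positions P \<and> h \<in> comp_space P q")
  case True
  then have "op_linear (comp_space P q) (comp_space P p) (A p q)"
    using assms by (simp add: op_matrices_iff)
  then show ?thesis using True by (auto simp: linear_between_def)
next
  case False
  then show ?thesis
    using assms ifc.subspace_0[OF comp_space_subspace] by (auto simp: op_matrix_outside)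
qed

lemma op_matrix_add:
  assumes A: "A \<in> op_matrices P" and q: "q \<in> positions P"
    and g: "g \<in> comp_space P q" and h: "h \<in> comp_space P q"
  shows "A p q (g + h) = A p q g + A p q h"
proof (cases "p \<in> positions P")
  case True
  then have "op_linear (comp_space P q) (comp_space P p) (A p q)" using A q by (simp add: op_matrices_iff)
  then show ?thesis using g h unfolding linear_between_def by blast
qed (use A in \<open>auto simp: op_matrix_outside\<close>)

lemma op_matrix_sum:
  assumes A: "A \<in> op_matrices P" and q: "q \<in> positions P"
    and f: "\<And>r. r \<in> S \<Longrightarrow> f r \<in> comp_space P q"
  shows "A p q (\<Sum>r\<in>S. f r) = (\<Sum>r\<in>S. A p q (f r))"
  using f
proof (induction S rule: infinite_finite_induct)
  case (insert r S)
  have "(\<Sum>r\<in>S. f r) \<in> comp_space P q"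
    using insert comp_space_subspace[OF q] by (intro ifc.subspace_sum) auto
  then show ?case using insert by (simp add: op_matrix_add[OF A q])
qed (simp_all add: op_matrix_0[OF A])

lemma carrier_matrix_ring [simp]: "carrier (matrix_ring P) = op_matrices P"
  by (simp add: matrix_ring_def)

lemma zero_matrix_ring [simp]: "\<zero>\<^bsub>matrix_ring P\<^esub> p q h = 0"
  by (simp add: matrix_ring_def)

lemma add_matrix_ring [simp]: "(A \<oplus>\<^bsub>matrix_ring P\<^esub> B) p q h = A p q h + B p q h"
  by (simp add: matrix_ring_def)

lemma mult_matrix_ring: "(A \<otimes>\<^bsub>matrix_ring P\<^esub> B) p q h = (\<Sum>r\<in>positions P. A p r (B r q h))"
  by (simp add: matrix_ring_def)

text \<open>The identity and the two block selectors are instances of one diagonal matrix, whose products with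
  other matrices only mask rows or columns.\<close>

definition projection :: "nat set \<Rightarrow> 'h op_matrix" where
  "projection S = normalize_matrix P (\<lambda>p q h. if p = q \<and> p \<in> S then h else 0)"

lemma one_matrix_ring: "\<one>\<^bsub>matrix_ring P\<^esub> = projection UNIV"
  by (simp add: matrix_ring_def projection_def)

lemma projection_closed: "projection S \<in> op_matrices P"
  unfolding projection_def
proof (rule normalize_matrix_closed)
  fix p q assume "p \<in> positions P" "q \<in> positions P"
  then show "op_linear (comp_space P q) (comp_space P p) (\<lambda>h. if p = q \<and> p \<in> S then h else 0)"
    using ifc.subspace_0[OF comp_space_subspace] by (auto simp: linear_between_def)
qed

lemma projection_mult:
  assumes A: "A \<in> op_matrices P"
  shows "(projection S \<otimes>\<^bsub>matrix_ring P\<^esub> A) p q h = (if p \<in> S then A p q h else 0)"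
proof (cases "p \<in> positions P")
  case True
  have "(projection S \<otimes>\<^bsub>matrix_ring P\<^esub> A) p q h
      = (\<Sum>r\<in>positions P. if r = p then (if p \<in> S then A p q h else 0) else 0)"
    unfolding mult_matrix_ring projection_def normalize_matrix_def
    using True op_matrix_mem[OF A] by (intro sum.cong) auto
  then show ?thesis using True finite_positions by simp
qed (use A in \<open>auto simp: mult_matrix_ring projection_def normalize_matrix_def op_matrix_outside\<close>)

lemma mult_projection:
  assumes A: "A \<in> op_matrices P"
  shows "(A \<otimes>\<^bsub>matrix_ring P\<^esub> projection S) p q h = (if q \<in> S then A p q h else 0)"
proof (cases "q \<in> positions P \<and> h \<in> comp_space P q")
  case True
  have "(A \<otimes>\<^bsub>matrix_ring P\<^esub> projection S) p q h
      = (\<Sum>r\<in>positions P. if r = q then (if q \<in> S then A p q h else 0) else 0)"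
    unfolding mult_matrix_ring projection_def normalize_matrix_def
    using True op_matrix_0[OF A] by (intro sum.cong) auto
  then show ?thesis using True finite_positions by simp
qed (use A in \<open>auto simp: mult_matrix_ring projection_def normalize_matrix_def op_matrix_outside op_matrix_0\<close>)

lemma matrix_add_closed:
  assumes A: "A \<in> op_matrices P" and B: "B \<in> op_matrices P"
  shows "A \<oplus>\<^bsub>matrix_ring P\<^esub> B \<in> op_matrices P"
proof -
  have "op_linear (comp_space P q) (comp_space P p) ((A \<oplus>\<^bsub>matrix_ring P\<^esub> B) p q)"
    if p: "p \<in> positions P" and q: "q \<in> positions P" for p q
  proof -
    have "op_linear (comp_space P q) (comp_space P p) (A p q)"
      "op_linear (comp_space P q) (comp_space P p) (B p q)"
      using A B p q by (auto simp: op_matrices_iff)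
    then show ?thesis
      using ifc.subspace_add[OF comp_space_subspace[OF p]]
      by (auto simp: linear_between_def ifc.scale_right_distrib Pi_iff ac_simps)
  qed
  then show ?thesis using A B by (auto simp: op_matrices_iff)
qed

lemma matrix_mult_closed:
  assumes A: "A \<in> op_matrices P" and B: "B \<in> op_matrices P"
  shows "A \<otimes>\<^bsub>matrix_ring P\<^esub> B \<in> op_matrices P"
proof -
  have "op_linear (comp_space P q) (comp_space P p) ((A \<otimes>\<^bsub>matrix_ring P\<^esub> B) p q)"
    if p: "p \<in> positions P" and q: "q \<in> positions P" for p q
  proof -
    have lin: "A p r (B r q (g + h)) = A p r (B r q g) + A p r (B r q h)"
      "A p r (B r q (ifc_scale P c h)) = ifc_scale P c (A p r (B r q h))"
      if "r \<in> positions P" "g \<in> comp_space P q" "h \<in> comp_space P q" for r g h c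
    proof -
      have "op_linear (comp_space P q) (comp_space P r) (B r q)"
        "op_linear (comp_space P r) (comp_space P p) (A p r)"
        using A B p q that by (auto simp: op_matrices_iff)
      then show "A p r (B r q (g + h)) = A p r (B r q g) + A p r (B r q h)"
        "A p r (B r q (ifc_scale P c h)) = ifc_scale P c (A p r (B r q h))"
        using that op_matrix_mem[OF B] by (auto simp: linear_between_def)
    qed
    have "(\<Sum>r\<in>positions P. A p r (B r q h)) \<in> comp_space P p" for h
      using comp_space_subspace[OF p] op_matrix_mem[OF A p] by (intro ifc.subspace_sum)
    then show ?thesis
      using lin by (simp add: linear_between_def mult_matrix_ring sum.distrib ifc.scale_sum_right)
  qed
  then show ?thesis
    using A B by (auto simp: op_matrices_iff op_matrix_0 mult_matrix_ring)
qed

text \<open>Distributivity from the left and associativity use additivity of the entries, which holds only on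
  the component spaces; the factors on the right take values there.\<close>

lemma ring_matrix_ring: "ring (matrix_ring P)"
proof (rule ringI)
  show "abelian_group (matrix_ring P)"
  proof (rule abelian_groupI)
    show "\<zero>\<^bsub>matrix_ring P\<^esub> \<in> carrier (matrix_ring P)"
      using ifc.subspace_0[OF comp_space_subspace] by (auto simp: op_matrices_iff linear_between_def)
    fix A assume A: "A \<in> carrier (matrix_ring P)"
    have "(\<lambda>p q h. - A p q h) \<in> op_matrices P"
      using A ifc.subspace_neg[OF comp_space_subspace]
      by (auto simp: op_matrices_iff linear_between_def Pi_iff)
    then show "\<exists>B\<in>carrier (matrix_ring P). B \<oplus>\<^bsub>matrix_ring P\<^esub> A = \<zero>\<^bsub>matrix_ring P\<^esub>"
      by (intro bexI[of _ "\<lambda>p q h. - A p q h"]) (auto simp: fun_eq_iff)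
  qed (auto simp: matrix_add_closed fun_eq_iff ac_simps)
  show "monoid (matrix_ring P)"
  proof (rule monoidI)
    fix A B C
    assume "A \<in> carrier (matrix_ring P)" "B \<in> carrier (matrix_ring P)" "C \<in> carrier (matrix_ring P)"
    then have A: "A \<in> op_matrices P" and B: "B \<in> op_matrices P" and C: "C \<in> op_matrices P" by auto
    have "(\<Sum>r\<in>positions P. \<Sum>s\<in>positions P. A p s (B s r (C r q h)))
        = (\<Sum>s\<in>positions P. A p s (\<Sum>r\<in>positions P. B s r (C r q h)))" for p q h
      using op_matrix_mem[OF B] by (subst sum.swap) (auto intro!: sum.cong simp: op_matrix_sum[OF A])
    then show "A \<otimes>\<^bsub>matrix_ring P\<^esub> B \<otimes>\<^bsub>matrix_ring P\<^esub> C
        = A \<otimes>\<^bsub>matrix_ring P\<^esub> (B \<otimes>\<^bsub>matrix_ring P\<^esub> C)"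
      by (simp add: fun_eq_iff mult_matrix_ring)
  qed (auto simp: matrix_mult_closed one_matrix_ring projection_closed projection_mult mult_projection fun_eq_iff)
  fix A B C
  assume "A \<in> carrier (matrix_ring P)" "B \<in> carrier (matrix_ring P)" "C \<in> carrier (matrix_ring P)"
  then have A: "A \<in> op_matrices P" and B: "B \<in> op_matrices P" and C: "C \<in> op_matrices P" by auto
  show "(A \<oplus>\<^bsub>matrix_ring P\<^esub> B) \<otimes>\<^bsub>matrix_ring P\<^esub> C
      = A \<otimes>\<^bsub>matrix_ring P\<^esub> C \<oplus>\<^bsub>matrix_ring P\<^esub> B \<otimes>\<^bsub>matrix_ring P\<^esub> C"
    by (simp add: fun_eq_iff mult_matrix_ring sum.distrib)
  show "C \<otimes>\<^bsub>matrix_ring P\<^esub> (A \<oplus>\<^bsub>matrix_ring P\<^esub> B)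
      = C \<otimes>\<^bsub>matrix_ring P\<^esub> A \<oplus>\<^bsub>matrix_ring P\<^esub> C \<otimes>\<^bsub>matrix_ring P\<^esub> B"
    using op_matrix_mem[OF A] op_matrix_mem[OF B]
    by (simp add: fun_eq_iff mult_matrix_ring op_matrix_add[OF C] sum.distrib)
qed

section \<open>Strictly lower triangular matrices\<close>

interpretation ring "matrix_ring P" by (rule ring_matrix_ring)

text \<open>Each further factor moves the support one diagonal further below the main diagonal.\<close>

lemma strictly_lower_pow:
  assumes A: "A \<in> op_matrices P" and lower: "\<And>p q h. p \<le> q \<Longrightarrow> A p q h = 0"
  shows "p < q + k \<Longrightarrow> (A [^]\<^bsub>matrix_ring P\<^esub> (k::nat)) p q h = 0"
proof (induction k arbitrary: p q h)
  case 0
  then show ?case by (simp add: one_matrix_ring projection_def normalize_matrix_def)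
next
  case (Suc k)
  have pow: "A [^]\<^bsub>matrix_ring P\<^esub> k \<in> op_matrices P" using nat_pow_closed[of A k] A by simp
  have "(A [^]\<^bsub>matrix_ring P\<^esub> k) p r (A r q h) = 0" for r
  proof (cases "r \<le> q")
    case True
    then show ?thesis using lower op_matrix_0[OF pow] by simp
  next
    case False
    then show ?thesis using Suc by simp
  qed
  then show ?case by (simp add: mult_matrix_ring)
qed

lemma one_minus_strictly_lower_Units:
  assumes A: "A \<in> op_matrices P" and lower: "\<And>p q h. p \<le> q \<Longrightarrow> A p q h = 0"
  shows "\<one>\<^bsub>matrix_ring P\<^esub> \<ominus>\<^bsub>matrix_ring P\<^esub> A \<in> Units (matrix_ring P)"
proof (rule one_minus_nilpotent_Units)
  \<comment> \<open>Any exponent not less than the number \<open>2N - 2\<close> of positions annihilates the matrix.\<close>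
  let ?k = "2 * nstrips P"
  have pow: "A [^]\<^bsub>matrix_ring P\<^esub> ?k \<in> op_matrices P" using nat_pow_closed[of A ?k] A by simp
  have "(A [^]\<^bsub>matrix_ring P\<^esub> ?k) p q h = 0" for p q h
  proof (cases "p \<in> positions P")
    case True
    then have "p < q + ?k" using two_strips by (auto simp: positions_def)
    then show ?thesis using strictly_lower_pow[OF A lower] by blast
  qed (use pow in \<open>auto simp: op_matrix_outside\<close>)
  then show "A [^]\<^bsub>matrix_ring P\<^esub> ?k = \<zero>\<^bsub>matrix_ring P\<^esub>" by (simp add: fun_eq_iff)
qed (use A in simp)

section \<open>The blocks of the substructured operator\<close>

lemma T_LR_closed: "T_LR P \<in> op_matrices P"
  unfolding T_LR_def
proof (rule normalize_matrix_closed)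
  fix p q assume "p \<in> positions P" "q \<in> positions P"
  then show "op_linear (comp_space P q) (comp_space P p) (T_entry P (LR P p) (LR P q))"
    using LR_is_interface T_entry_linear
    by (cases "LR P p"; cases "LR P q") (auto simp: comp_space_def)
qed

abbreviation "left_positions \<equiv> {1..nstrips P - 1}"
abbreviation "right_positions \<equiv> {nstrips P..2 * nstrips P - 2}"

lemma I_l_projection: "I_l P = projection left_positions"
  by (simp add: I_l_def projection_def)

lemma I_r_projection: "I_r P = projection right_positions"
  by (simp add: I_r_def projection_def)

lemma transpose_projection: "matrix_transpose (projection S) = projection S"
  by (auto simp: projection_def matrix_transpose_def normalize_matrix_def fun_eq_iff)

lemma M_l_entry: "M_l P p q h = (if p \<in> left_positions \<and> q \<in> left_positions then T_LR P p q h else 0)"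
  by (simp add: M_l_def I_l_projection transpose_projection mult_projection projection_mult projection_closed
      matrix_mult_closed T_LR_closed)

lemma M_r_entry: "M_r P p q h = (if p \<in> right_positions \<and> q \<in> right_positions then T_LR P p q h else 0)"
  by (simp add: M_r_def I_r_projection transpose_projection mult_projection projection_mult projection_closed
      matrix_mult_closed T_LR_closed)

text \<open>Among the left interfaces, each receives data only from its predecessor, which the left-right
  numbering puts before it. The right interfaces are numbered in the opposite direction,
  so that the sweep to the left is lower triangular as well.\<close>

lemma M_l_lower: "p \<le> q \<Longrightarrow> M_l P p q h = 0"
  by (auto simp: M_l_entry T_LR_def normalize_matrix_def LR_def)

lemma M_r_lower: "p \<le> q \<Longrightarrow> M_r P p q h = 0"
  using two_strips by (auto simp: M_r_entry T_LR_def normalize_matrix_def LR_def)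

lemma projection_disjoint:
  "S \<inter> S' = {} \<Longrightarrow> projection S \<otimes>\<^bsub>matrix_ring P\<^esub> projection S' = \<zero>\<^bsub>matrix_ring P\<^esub>"
  by (auto simp: fun_eq_iff projection_mult projection_closed) (auto simp: projection_def normalize_matrix_def)

lemma projection_sum_one:
  "projection left_positions \<oplus>\<^bsub>matrix_ring P\<^esub> projection right_positions = \<one>\<^bsub>matrix_ring P\<^esub>"
  using two_strips
  by (auto simp: fun_eq_iff one_matrix_ring projection_def normalize_matrix_def positions_def)

lemma block_symmetric_gauss_seidel_error:
  shows "C_l P \<in> op_matrices P" "C_r P \<in> op_matrices P" "C_l P \<otimes>\<^bsub>matrix_ring P\<^esub> C_l P = \<zero>\<^bsub>matrix_ring P\<^esub>"
    "R_BSGS P = (\<one>\<^bsub>matrix_ring P\<^esub> \<oplus>\<^bsub>matrix_ring P\<^esub> C_l P)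
        \<otimes>\<^bsub>matrix_ring P\<^esub> C_r P \<otimes>\<^bsub>matrix_ring P\<^esub> C_l P"
proof -
  let ?R = "matrix_ring P"
  define e where "e = projection left_positions"
  define f where "f = projection right_positions"
  define T where "T = T_LR P"
  have carr: "e \<in> carrier ?R" "f \<in> carrier ?R" "T \<in> carrier ?R"
    by (simp_all add: e_def f_def T_def projection_closed T_LR_closed)
  have zero: "e \<otimes>\<^bsub>?R\<^esub> f = \<zero>\<^bsub>?R\<^esub>" "f \<otimes>\<^bsub>?R\<^esub> e = \<zero>\<^bsub>?R\<^esub>"
    unfolding e_def f_def using two_strips by (intro projection_disjoint; auto)+
  have zero': "e \<otimes>\<^bsub>?R\<^esub> (f \<otimes>\<^bsub>?R\<^esub> x) = \<zero>\<^bsub>?R\<^esub>" "f \<otimes>\<^bsub>?R\<^esub> (e \<otimes>\<^bsub>?R\<^esub> x) = \<zero>\<^bsub>?R\<^esub>"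
    if "x \<in> carrier ?R" for x
    using that carr zero by (metis l_null m_assoc)+
  have blocks: "M_l P = e \<otimes>\<^bsub>?R\<^esub> T \<otimes>\<^bsub>?R\<^esub> e" "A_l P = e \<otimes>\<^bsub>?R\<^esub> T \<otimes>\<^bsub>?R\<^esub> f"
    "A_r P = f \<otimes>\<^bsub>?R\<^esub> T \<otimes>\<^bsub>?R\<^esub> e" "M_r P = f \<otimes>\<^bsub>?R\<^esub> T \<otimes>\<^bsub>?R\<^esub> f"
    by (simp_all add: M_l_def A_l_def A_r_def M_r_def I_l_projection I_r_projection transpose_projection e_def f_def T_def)
  have closed: "M_l P \<in> carrier ?R" "M_r P \<in> carrier ?R" "A_l P \<in> carrier ?R" "A_r P \<in> carrier ?R"
    unfolding blocks using carr by (simp_all only: m_closed)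
  have units: "\<one>\<^bsub>?R\<^esub> \<ominus>\<^bsub>?R\<^esub> M_l P \<in> Units ?R" "\<one>\<^bsub>?R\<^esub> \<ominus>\<^bsub>?R\<^esub> M_r P \<in> Units ?R"
    using closed M_l_lower M_r_lower by (simp_all add: one_minus_strictly_lower_Units)
  have sum_one: "e \<oplus>\<^bsub>?R\<^esub> f = \<one>\<^bsub>?R\<^esub>"
    unfolding e_def f_def by (rule projection_sum_one)
  have "T = (e \<oplus>\<^bsub>?R\<^esub> f) \<otimes>\<^bsub>?R\<^esub> T \<otimes>\<^bsub>?R\<^esub> (e \<oplus>\<^bsub>?R\<^esub> f)"
    unfolding sum_one using carr(3) by (simp only: l_one r_one)
  also have "\<dots> = M_l P \<oplus>\<^bsub>?R\<^esub> A_l P \<oplus>\<^bsub>?R\<^esub> (A_r P \<oplus>\<^bsub>?R\<^esub> M_r P)"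
    unfolding blocks using carr
    by (simp only: l_distr r_distr a_closed m_closed a_ac)
  finally have T: "T_LR P = M_l P \<oplus>\<^bsub>?R\<^esub> A_l P \<oplus>\<^bsub>?R\<^esub> (A_r P \<oplus>\<^bsub>?R\<^esub> M_r P)"
    unfolding T_def .
  have products: "M_r P \<otimes>\<^bsub>?R\<^esub> M_l P = \<zero>\<^bsub>?R\<^esub>" "M_l P \<otimes>\<^bsub>?R\<^esub> M_r P = \<zero>\<^bsub>?R\<^esub>"
    "A_l P \<otimes>\<^bsub>?R\<^esub> A_l P = \<zero>\<^bsub>?R\<^esub>" "A_r P \<otimes>\<^bsub>?R\<^esub> A_r P = \<zero>\<^bsub>?R\<^esub>"
    "A_l P \<otimes>\<^bsub>?R\<^esub> M_l P = \<zero>\<^bsub>?R\<^esub>" "A_r P \<otimes>\<^bsub>?R\<^esub> M_r P = \<zero>\<^bsub>?R\<^esub>"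
    "M_r P \<otimes>\<^bsub>?R\<^esub> A_l P = \<zero>\<^bsub>?R\<^esub>" "M_l P \<otimes>\<^bsub>?R\<^esub> A_r P = \<zero>\<^bsub>?R\<^esub>"
    unfolding blocks using carr by (simp_all only: m_assoc m_closed zero' r_null)
  note main = block_splitting_gauss_seidel_error[OF closed units products]
  show "C_l P \<in> op_matrices P" "C_r P \<in> op_matrices P" "C_l P \<otimes>\<^bsub>?R\<^esub> C_l P = \<zero>\<^bsub>?R\<^esub>"
    "R_BSGS P = (\<one>\<^bsub>?R\<^esub> \<oplus>\<^bsub>?R\<^esub> C_l P) \<otimes>\<^bsub>?R\<^esub> C_r P \<otimes>\<^bsub>?R\<^esub> C_l P"
    using main unfolding R_BSGS_def BSGS_def C_l_def C_r_def T carrier_matrix_ring by simp_all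
qed

end

theorem proposition4p6:
  fixes P :: "('h::ab_group_add, 'b::ab_group_add) strip_decomposition"
  assumes "helmholtz_strips P"
  shows "R_BSGS P =
      (\<one>\<^bsub>matrix_ring P\<^esub> \<oplus>\<^bsub>matrix_ring P\<^esub> C_l P)
        \<otimes>\<^bsub>matrix_ring P\<^esub> C_r P \<otimes>\<^bsub>matrix_ring P\<^esub> C_l P
    \<and> (\<forall>n::nat. n \<ge> 1 \<longrightarrow> R_BSGS P [^]\<^bsub>matrix_ring P\<^esub> n =
      (\<one>\<^bsub>matrix_ring P\<^esub> \<oplus>\<^bsub>matrix_ring P\<^esub> C_l P)
        \<otimes>\<^bsub>matrix_ring P\<^esub> (C_r P \<otimes>\<^bsub>matrix_ring P\<^esub> C_l P) [^]\<^bsub>matrix_ring P\<^esub> n)"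
proof -
  interpret helmholtz_strips P by fact
  show ?thesis
    using block_symmetric_gauss_seidel_error ring.pow_one_plus_square_zero_mult[OF ring_matrix_ring, of "C_l P" "C_r P"]
    by simp
qed

end
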